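(* Let $p \in \mathbb{N} \setminus \{1\}$, let $\mathbb{X} = l_p^2$ (over $\mathbb{R}$), and let $T \in \mathbb{L}(\mathbb{X})$ be such that $T$ is not a scalar multiple of an isometry. Then $|M_T| \leq 2(8p - 5)$.
   Context: $\mathbb{N}$ denotes the positive integers, so $p \ge 2$ is an integer. $l_p^2$ is $\mathbb{R}^2$ with the norm $\|(x,y)\| = (|x|^p + |y|^p)^{1/p}$. $\mathbb{L}(\mathbb{X})$ is the space of linear operators on $\mathbb{X}$ with the operator norm. $S_{\mathbb{X}} = \{x \in \mathbb{X} : \|x\| = 1\}$, $M_T = \{x \in S_{\mathbb{X}} : \|Tx\| = \|T\|\}$, and $|M_T|$ is the cardinality of $M_T$. The zero operator counts as a scalar multiple of an isometry. *)

theory Defs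
  imports "HOL-Analysis.Analysis"
begin

text \<open>
  The exponent \<open>p\<close> is a variable, so \<open>l\<^sub>p\<^sup>2\<close> cannot be an instance of
  the class of normed spaces. The vector space \<open>real ^ 2\<close> is used together with the explicit
  norm below; its built-in Euclidean \<open>norm\<close> and \<open>onorm\<close> play no role.
\<close>

definition lp_norm :: "nat \<Rightarrow> real ^ 2 \<Rightarrow> real" where
  "lp_norm p v = (\<bar>v $ 1\<bar> ^ p + \<bar>v $ 2\<bar> ^ p) powr (1 / real p)"

definition lp_sphere :: "nat \<Rightarrow> (real ^ 2) set" where
  "lp_sphere p = {v. lp_norm p v = 1}"

text \<open>
  For \<open>p \<ge> 1\<close> and linear \<open>T\<close> the supremum ranges over a nonempty bounded set of reals.
\<close>

definition lp_onorm :: "nat \<Rightarrow> (real ^ 2 \<Rightarrow> real ^ 2) \<Rightarrow> real" where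
  "lp_onorm p T = (SUP v\<in>lp_sphere p. lp_norm p (T v))"

definition norm_attainment_set :: "nat \<Rightarrow> (real ^ 2 \<Rightarrow> real ^ 2) \<Rightarrow> (real ^ 2) set" where
  "norm_attainment_set p T = {v \<in> lp_sphere p. lp_norm p (T v) = lp_onorm p T}"

definition lp_isometry :: "nat \<Rightarrow> (real ^ 2 \<Rightarrow> real ^ 2) \<Rightarrow> bool" where
  "lp_isometry p U \<longleftrightarrow> linear U \<and> (\<forall>v. lp_norm p (U v) = lp_norm p v)"

text \<open>The scalar may be \<open>0\<close>, so the zero operator qualifies.\<close>

definition scalar_multiple_of_lp_isometry :: "nat \<Rightarrow> (real ^ 2 \<Rightarrow> real ^ 2) \<Rightarrow> bool" where
  "scalar_multiple_of_lp_isometry p T \<longleftrightarrow>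
     (\<exists>c U. lp_isometry p U \<and> T = (\<lambda>v. c *\<^sub>R U v))"

end

theory Submission
  imports Defs "HOL-Computational_Algebra.Polynomial"
begin

text \<open>
  A vector \<open>(x, y)\<close> of the unit sphere at which the operator \<open>(x, y) \<mapsto> (a x + b y, c x + d y)\<close>
  attains its norm satisfies
  \<open>\<bar>a x + b y\<bar>\<^sup>p + \<bar>c x + d y\<bar>\<^sup>p = M (\<bar>x\<bar>\<^sup>p + \<bar>y\<bar>\<^sup>p)\<close>, where \<open>M\<close> is the \<open>p\<close>-th power of the
  operator norm. Both sides are homogeneous, so apart from the two points with \<open>x = 0\<close> only the
  slope \<open>t = y / x\<close> matters, and every slope belongs to two points of the sphere. The theorem
  follows once there are at most \<open>4 p\<close> slopes, because \<open>2 (4 p) + 2 \<le> 2 (8 p - 5)\<close> for \<open>p \<ge> 2\<close>.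

  In terms of \<open>t\<close> the equation reads \<open>\<bar>a + b t\<bar>\<^sup>p + \<bar>c + d t\<bar>\<^sup>p = M (1 + \<bar>t\<bar>\<^sup>p)\<close>. The zeros of
  \<open>a + b t\<close>, \<open>c + d t\<close> and \<open>t\<close> cut the line into at most four pieces. On each piece the absolute
  values are fixed signs, so the equation is polynomial of degree at most \<open>p\<close>, and it has at most
  \<open>p\<close> solutions there unless the polynomial equation is an identity.

  It remains to see that an identity on a single piece makes the operator a multiple of an
  isometry. For even \<open>p\<close> the signs disappear, so the identity holds for all vectors. For odd \<open>p\<close>
  it has the form \<open>(a + b t)\<^sup>p + (c + d t)\<^sup>p = M + e t\<^sup>p\<close> with \<open>\<bar>e\<bar> = M\<close>, and the vanishing of the
  coefficients of \<open>t\<close> and of \<open>t\<close> to the power \<open>p - 1\<close> forces the matrix of the operator to be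
  diagonal or antidiagonal with nonzero entries of equal modulus
  (\<open>sum_of_odd_powers_is_diagonal_imp_monomial\<close>).
\<close>

section \<open>The real line cut at finitely many points\<close>

text \<open>
  The fibres of this counting function are the half-open intervals into which \<open>B\<close> cuts the line;
  numbering the pieces in this way avoids sorting the points of \<open>B\<close>.
\<close>

definition cuts_below :: "real set \<Rightarrow> real \<Rightarrow> nat" where
  "cuts_below B t = card {\<beta> \<in> B. \<beta> < t}"

text \<open>
  The sets \<open>{\<beta> \<in> B. \<beta> < t}\<close> form a chain as \<open>t\<close> varies, so two of them with the same
  cardinality coincide.
\<close>

lemma cuts_below_eq_imp_same_side:
  assumes "finite B" "cuts_below B t = cuts_below B u" "\<beta> \<in> B"
  shows "\<beta> < t \<longleftrightarrow> \<beta> < u"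
proof -
  have same: "{\<beta> \<in> B. \<beta> < t} = {\<beta> \<in> B. \<beta> < u}"
  proof (cases "t \<le> u")
    case True
    then have "{\<beta> \<in> B. \<beta> < t} \<subseteq> {\<beta> \<in> B. \<beta> < u}" by auto
    then show ?thesis
      using assms by (intro card_subset_eq) (auto simp: cuts_below_def)
  next
    case False
    then have "{\<beta> \<in> B. \<beta> < u} \<subseteq> {\<beta> \<in> B. \<beta> < t}" by auto
    then show ?thesis
      using assms by (intro card_subset_eq[symmetric]) (auto simp: cuts_below_def)
  qed
  from same have "\<beta> \<in> {\<beta> \<in> B. \<beta> < t} \<longleftrightarrow> \<beta> \<in> {\<beta> \<in> B. \<beta> < u}" by simp
  with assms(3) show ?thesis by simp
qed

text \<open>
  The sign of \<open>a + b t\<close> changes only at \<open>- a / b\<close>, where the value is \<open>0\<close> and either sign will do.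
  For \<open>b = 0\<close> the quotient is \<open>0\<close> by convention, but then the sign is constant on the whole line.
\<close>

lemma abs_affine_sign_on_piece:
  fixes a b :: real
  assumes "finite B" "- a / b \<in> B"
  obtains s where "s = 1 \<or> s = - 1"
    and "\<And>t. cuts_below B t = k \<Longrightarrow> \<bar>a + b * t\<bar> = s * (a + b * t)"
proof (cases "\<exists>u. cuts_below B u = k")
  case False
  then show ?thesis using that[of 1] by blast
next
  case True
  then obtain u where u: "cuts_below B u = k" by blast
  have side: "- a / b < t \<longleftrightarrow> - a / b < u" if "cuts_below B t = k" for t
    using cuts_below_eq_imp_same_side[OF assms(1) _ assms(2), of t u] that u by simp
  consider "b = 0" | "b > 0" | "b < 0" by linarith
  then show ?thesis
  proof cases
    case 1
    then show ?thesis
      using that[of "if a \<ge> 0 then 1 else - 1"] by (auto split: if_splits)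
  next
    case 2
    have "- a / b < t \<longleftrightarrow> 0 < a + b * t" for t
      using 2 by (simp add: field_simps) linarith
    with side have sgn: "0 < a + b * t \<longleftrightarrow> 0 < a + b * u" if "cuts_below B t = k" for t
      using that by blast
    show ?thesis
    proof (rule that[of "if 0 < a + b * u then 1 else - 1"])
      show "\<bar>a + b * t\<bar> = (if 0 < a + b * u then 1 else - 1) * (a + b * t)"
        if "cuts_below B t = k" for t
        using sgn[OF that] by (cases "0 < a + b * u") simp_all
    qed simp
  next
    case 3
    have "- a / b < t \<longleftrightarrow> a + b * t < 0" for t
      using 3 by (simp add: field_simps) linarith
    with side have "a + b * t < 0 \<longleftrightarrow> a + b * u < 0" if "cuts_below B t = k" for t
      using that by blast
    then show ?thesis
      by (intro that[of "if a + b * u < 0 then - 1 else 1"]) (auto simp: abs_if)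
  qed
qed

lemma card_le_sum_pieces:
  assumes "finite B" and "\<And>k. finite {t \<in> Z. cuts_below B t = k}"
    and "\<And>k. card {t \<in> Z. cuts_below B t = k} \<le> n"
  shows "finite Z" and "card Z \<le> (card B + 1) * n"
proof -
  have "cuts_below B t \<le> card B" for t
    unfolding cuts_below_def by (rule card_mono[OF assms(1)]) auto
  then have Z: "Z = (\<Union>k\<le>card B. {t \<in> Z. cuts_below B t = k})" by auto
  show "finite Z" by (subst Z) (use assms(2) in auto)
  have "card Z \<le> (\<Sum>k\<le>card B. card {t \<in> Z. cuts_below B t = k})"
    by (subst Z) (rule card_UN_le, simp)
  also have "\<dots> \<le> (\<Sum>k\<le>card B. n)"
    by (rule sum_mono) (rule assms(3))
  finally show "card Z \<le> (card B + 1) * n" by simp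
qed

section \<open>Sums of two powers of linear forms\<close>

text \<open>
  Comparing the coefficients of degree \<open>1\<close> and \<open>p - 1\<close> gives
  \<open>a ^ (p - 1) * b + c ^ (p - 1) * d = 0\<close> and \<open>a * b ^ (p - 1) + c * d ^ (p - 1) = 0\<close>.
  If no entry vanishes, eliminating \<open>b / d\<close> yields \<open>(c / a) ^ (p * (p - 2)) = - 1\<close>. The exponent is
  odd, hence \<open>c = - a\<close>, and the constant coefficient \<open>M = a ^ p + c ^ p\<close> would be \<open>0\<close>. If some entry
  vanishes, the two equations together with the nonzero extreme coefficients leave only the
  two monomial matrices.
\<close>

lemma sum_of_odd_powers_is_diagonal_imp_monomial:
  fixes a b c d M e :: real
  assumes "odd p" "p \<ge> 3" "M \<noteq> 0" "e \<noteq> 0"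
    and eq: "[:a, b:] ^ p + [:c, d:] ^ p = [:M:] + monom e p"
  shows "b = 0 \<and> c = 0 \<and> a ^ p = M \<and> d ^ p = e \<or> a = 0 \<and> d = 0 \<and> c ^ p = M \<and> b ^ p = e"
proof -
  have c: "real (p choose i) * b ^ i * a ^ (p - i) + real (p choose i) * d ^ i * c ^ (p - i)
      = coeff [:M:] i + (if p = i then e else 0)" if "i \<le> p" for i
    using arg_cong[OF eq, of "\<lambda>q. coeff q i"] that by (simp add: coeff_linear_poly_power)
  have M: "a ^ p + c ^ p = M" using c[of 0] assms(2) by simp
  have e: "b ^ p + d ^ p = e" using c[of p] assms(2) by (simp add: coeff_pCons split: nat.splits)
  have "real p * (b * a ^ (p - 1) + d * c ^ (p - 1)) = 0"
    using c[of 1] assms(2) by (simp add: algebra_simps)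
  then have c1: "b * a ^ (p - 1) = - (d * c ^ (p - 1))" using assms(2) by simp
  have choose: "p choose (p - 1) = p" "p - (p - 1) = 1"
    using assms(2) binomial_symmetric[of 1 p] by simp_all
  have "real p * (b ^ (p - 1) * a + d ^ (p - 1) * c) = 0"
    using c[of "p - 1"] assms(2) choose
    by (simp add: coeff_pCons algebra_simps split: nat.splits)
  then have c2: "b ^ (p - 1) * a = - (d ^ (p - 1) * c)" using assms(2) by simp
  have p0: "p > 0" "p - 1 > 0" using assms(2) by auto
  have "\<not> (a \<noteq> 0 \<and> b \<noteq> 0 \<and> c \<noteq> 0 \<and> d \<noteq> 0)"
  proof
    assume nz: "a \<noteq> 0 \<and> b \<noteq> 0 \<and> c \<noteq> 0 \<and> d \<noteq> 0"
    have s: "b / d = - ((c / a) ^ (p - 1))" and r: "(b / d) ^ (p - 1) = - (c / a)"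
      using c1 c2 nz by (simp_all add: field_simps)
    obtain q where q: "p = Suc (Suc q)" "odd q"
      using assms(1,2) that[of "p - 2"] by simp
    \<comment> \<open>Writing \<open>p = q + 2\<close> turns \<open>(p - 1)\<^sup>2 - 1\<close> into \<open>p * q\<close>.\<close>
    have "((c / a) ^ (p - 1)) ^ (p - 1) = - (c / a)"
      using r assms(1) unfolding s by simp
    moreover have "(p - 1) * (p - 1) = Suc (p * q)" using q by simp
    ultimately have "(c / a) * (c / a) ^ (p * q) = (c / a) * (- 1)"
      by (simp flip: power_mult)
    then have "(c / a) ^ (p * q) = - 1" using nz by (subst (asm) mult_cancel_left) simp
    moreover have "odd (p * q)" using q assms(1) by simp
    then have "(-1::real) ^ (p * q) = - 1" by simp
    ultimately have "c / a = - 1"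
      using \<open>odd (p * q)\<close> by (metis odd_pos odd_real_root_power_cancel)
    then have "c = - a" using nz by (simp add: field_simps)
    then show False using M assms(1,3) by simp
  qed
  then show ?thesis
    using M e c1 c2 p0 assms(3,4) by (auto simp: zero_power)
qed

text \<open>
  The operator with matrix rows \<open>(a, b)\<close> and \<open>(c, d)\<close> multiplies the \<open>p\<close>-th power of the norm of
  every vector by the same factor \<open>M\<close>. This is the exceptional case, and it says that the operator
  is a multiple of an isometry.
\<close>

definition norm_ratio_const :: "nat \<Rightarrow> real \<Rightarrow> real \<Rightarrow> real \<Rightarrow> real \<Rightarrow> real \<Rightarrow> bool" where
  "norm_ratio_const p M a b c d \<longleftrightarrow>
     (\<forall>x y. \<bar>a * x + b * y\<bar> ^ p + \<bar>c * x + d * y\<bar> ^ p = M * (\<bar>x\<bar> ^ p + \<bar>y\<bar> ^ p))"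

text \<open>
  Even powers absorb absolute values, so it suffices to homogenise the identity; the vectors with
  first coordinate \<open>0\<close> are covered by the leading coefficient.
\<close>

lemma polynomial_identity_imp_norm_ratio_const_even:
  fixes a b c d M :: real
  assumes "even p" "p \<ge> 2"
    and eq: "[:a, b:] ^ p + [:c, d:] ^ p = [:M:] + monom M p"
  shows "norm_ratio_const p M a b c d"
proof -
  have aff: "(a + b * t) ^ p + (c + d * t) ^ p = M * (1 + t ^ p)" for t
    using arg_cong[OF eq, of "\<lambda>q. poly q t"] by (simp add: poly_monom algebra_simps)
  have "(a * x + b * y) ^ p + (c * x + d * y) ^ p = M * (x ^ p + y ^ p)" for x y
  proof (cases "x = 0")
    case True
    have "b ^ p + d ^ p = M"
      using arg_cong[OF eq, of "\<lambda>q. coeff q p"] assms(2)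
      by (simp add: coeff_linear_poly_power coeff_pCons split: nat.splits)
    then show ?thesis
      using True assms(2) by (simp add: power_mult_distrib zero_power flip: distrib_right)
  next
    case False
    have "a * x + b * y = x * (a + b * (y / x))" "c * x + d * y = x * (c + d * (y / x))"
      using False by (simp_all add: distrib_left mult.commute)
    then have "(a * x + b * y) ^ p + (c * x + d * y) ^ p
        = x ^ p * ((a + b * (y / x)) ^ p + (c + d * (y / x)) ^ p)"
      by (metis power_mult_distrib distrib_left)
    also have "\<dots> = M * (x ^ p + y ^ p)"
      unfolding aff using False by (simp add: field_simps power_divide)
    finally show ?thesis .
  qed
  then show ?thesis
    using assms(1) by (simp add: norm_ratio_const_def power_even_abs)
qed

lemma polynomial_identity_imp_norm_ratio_const_odd:
  fixes a b c d M e :: real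
  assumes "odd p" "p \<ge> 2" "M > 0" "\<bar>e\<bar> = M"
    and eq: "[:a, b:] ^ p + [:c, d:] ^ p = [:M:] + monom e p"
  shows "norm_ratio_const p M a b c d"
proof -
  have "p \<ge> 3" using assms(1,2) by (cases "p = 2") auto
  moreover have "M \<noteq> 0" "e \<noteq> 0" using assms(3,4) by auto
  ultimately consider "b = 0" "c = 0" "a ^ p = M" "d ^ p = e"
    | "a = 0" "d = 0" "c ^ p = M" "b ^ p = e"
    using sum_of_odd_powers_is_diagonal_imp_monomial[OF assms(1) _ _ _ eq] by blast
  then show ?thesis
  proof cases
    case 1
    then have "\<bar>a\<bar> ^ p = M" "\<bar>d\<bar> ^ p = M"
      using assms(3,4) by (simp_all flip: power_abs)
    with 1 show ?thesis
      by (simp add: norm_ratio_const_def abs_mult power_mult_distrib distrib_left)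
  next
    case 2
    then have "\<bar>c\<bar> ^ p = M" "\<bar>b\<bar> ^ p = M"
      using assms(3,4) by (simp_all flip: power_abs)
    with 2 show ?thesis
      by (simp add: norm_ratio_const_def abs_mult power_mult_distrib distrib_left)
  qed
qed

lemma norm_ratio_const_signs:
  assumes "s = 1 \<or> s = - 1" "s' = 1 \<or> s' = - 1"
  shows "norm_ratio_const p M (s * a) (s * b) (s' * c) (s' * d) \<longleftrightarrow> norm_ratio_const p M a b c d"
proof -
  have "\<bar>s * a * x + s * b * y\<bar> = \<bar>a * x + b * y\<bar>" for x y
    using abs_mult[of s "a * x + b * y"] assms(1) by (auto simp: algebra_simps)
  moreover have "\<bar>s' * c * x + s' * d * y\<bar> = \<bar>c * x + d * y\<bar>" for x y
    using abs_mult[of s' "c * x + d * y"] assms(2) by (auto simp: algebra_simps)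
  ultimately show ?thesis unfolding norm_ratio_const_def by simp
qed

section \<open>Level sets of the norm ratio\<close>

definition level_slopes :: "nat \<Rightarrow> real \<Rightarrow> real \<Rightarrow> real \<Rightarrow> real \<Rightarrow> real \<Rightarrow> real set" where
  "level_slopes p M a b c d = {t. \<bar>a + b * t\<bar> ^ p + \<bar>c + d * t\<bar> ^ p = M * (1 + \<bar>t\<bar> ^ p)}"

text \<open>
  A solution with \<open>M \<le> 0\<close> makes both affine functions vanish and forces \<open>M = 0\<close>. Two distinct
  solutions would make the matrix \<open>0\<close>, whose norm ratio is constant.
\<close>

lemma card_level_slopes_nonpos:
  fixes a b c d M :: real
  assumes p: "p \<ge> 2" and M: "M \<le> 0" and nid: "\<not> norm_ratio_const p M a b c d"
  shows "finite (level_slopes p M a b c d) \<and> card (level_slopes p M a b c d) \<le> 1"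
proof -
  let ?Z = "level_slopes p M a b c d"
  have z: "a + b * t = 0 \<and> c + d * t = 0 \<and> M = 0" if "t \<in> ?Z" for t
  proof -
    have pos: "1 + \<bar>t\<bar> ^ p > 0" by (simp add: add_pos_nonneg)
    have eq: "\<bar>a + b * t\<bar> ^ p + \<bar>c + d * t\<bar> ^ p = M * (1 + \<bar>t\<bar> ^ p)"
      using that by (simp add: level_slopes_def)
    have "M * (1 + \<bar>t\<bar> ^ p) \<le> 0" using M pos by (simp add: mult_nonpos_nonneg)
    moreover have "\<bar>a + b * t\<bar> ^ p \<ge> 0" "\<bar>c + d * t\<bar> ^ p \<ge> 0" by simp_all
    ultimately have "\<bar>a + b * t\<bar> ^ p = 0" "\<bar>c + d * t\<bar> ^ p = 0" "M * (1 + \<bar>t\<bar> ^ p) = 0"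
      using eq by linarith+
    with pos show ?thesis by auto
  qed
  have "t = u" if "t \<in> ?Z" "u \<in> ?Z" for t u
  proof (rule ccontr)
    assume "t \<noteq> u"
    have "b * t = b * u" "d * t = d * u"
      using z[OF that(1)] z[OF that(2)] by linarith+
    with \<open>t \<noteq> u\<close> have "b = 0" "d = 0" by simp_all
    with z[OF that(1)] have "a = 0" "c = 0" by simp_all
    with \<open>b = 0\<close> \<open>d = 0\<close> nid z[OF that(1)] p show False
      by (simp add: norm_ratio_const_def zero_power)
  qed
  \<comment> \<open>The singleton also bounds an empty solution set, whose chosen element is arbitrary.\<close>
  then have sub: "?Z \<subseteq> {SOME t. t \<in> ?Z}" by (metis (lifting) singletonI someI subsetI)
  show ?thesis using card_mono[OF _ sub] finite_subset[OF sub] by simp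
qed

text \<open>
  On one piece the solutions are roots of a polynomial of degree at most \<open>p\<close>. Flipping the sign of
  a row of the matrix does not affect the norm ratio, so the polynomial is not zero: otherwise the
  ratio would be constant.
\<close>

lemma card_level_slopes_piece:
  fixes a b c d M :: real and k :: nat
  assumes p: "p \<ge> 2" and M: "M > 0" and nid: "\<not> norm_ratio_const p M a b c d"
    and B: "finite B" "- a / b \<in> B" "- c / d \<in> B" "0 \<in> B"
  defines "Zk \<equiv> {t \<in> level_slopes p M a b c d. cuts_below B t = k}"
  shows "finite Zk \<and> card Zk \<le> p"
proof -
  obtain s1 where s1: "s1 = 1 \<or> s1 = - 1"
    "\<And>t. cuts_below B t = k \<Longrightarrow> \<bar>a + b * t\<bar> = s1 * (a + b * t)"
    using abs_affine_sign_on_piece[OF B(1,2)] by metis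
  obtain s2 where s2: "s2 = 1 \<or> s2 = - 1"
    "\<And>t. cuts_below B t = k \<Longrightarrow> \<bar>c + d * t\<bar> = s2 * (c + d * t)"
    using abs_affine_sign_on_piece[OF B(1,3)] by metis
  obtain s3 where s3: "s3 = 1 \<or> s3 = - 1"
    "\<And>t. cuts_below B t = k \<Longrightarrow> \<bar>t\<bar> = s3 * t"
    using abs_affine_sign_on_piece[of B 0 1 k] B(1,4) by auto
  define R where "R = [:M:] + monom (M * s3 ^ p) p"
  define L where "L = [:s1 * a, s1 * b:] ^ p + [:s2 * c, s2 * d:] ^ p"
  have "L \<noteq> R"
  proof
    assume "L = R"
    have "norm_ratio_const p M (s1 * a) (s1 * b) (s2 * c) (s2 * d)"
    proof (cases "even p")
      case True
      then have "M * s3 ^ p = M" using s3(1) by auto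
      with polynomial_identity_imp_norm_ratio_const_even[OF True p] \<open>L = R\<close>
      show ?thesis by (simp add: L_def R_def)
    next
      case False
      then have "\<bar>M * s3 ^ p\<bar> = M" using s3(1) M by (auto simp: abs_mult)
      with polynomial_identity_imp_norm_ratio_const_odd[OF False p M] \<open>L = R\<close>
      show ?thesis by (simp add: L_def R_def)
    qed
    with nid norm_ratio_const_signs[OF s1(1) s2(1)] show False by simp
  qed
  then have nz: "L - R \<noteq> 0" by simp
  have deg: "degree (L - R) \<le> p"
    unfolding L_def R_def
    by (intro degree_diff_le degree_add_le order.trans[OF degree_power_le])
       (auto intro: order.trans[OF degree_monom_le])
  have sub: "Zk \<subseteq> {t. poly (L - R) t = 0}"
  proof
    fix t assume "t \<in> Zk"
    then have k: "cuts_below B t = k"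
      and t: "\<bar>a + b * t\<bar> ^ p + \<bar>c + d * t\<bar> ^ p = M * (1 + \<bar>t\<bar> ^ p)"
      by (auto simp: Zk_def level_slopes_def)
    have "poly L t = (s1 * (a + b * t)) ^ p + (s2 * (c + d * t)) ^ p"
      by (simp add: L_def algebra_simps)
    moreover have "poly R t = M * (1 + (s3 * t) ^ p)"
      by (simp add: R_def poly_monom algebra_simps power_mult_distrib)
    ultimately show "t \<in> {t. poly (L - R) t = 0}"
      using t unfolding s1(2)[OF k] s2(2)[OF k] s3(2)[OF k] by simp
  qed
  have "card Zk \<le> card {t. poly (L - R) t = 0}"
    by (rule card_mono[OF poly_roots_finite[OF nz] sub])
  also have "\<dots> \<le> degree (L - R)" by (rule card_poly_roots_bound[OF nz])
  finally show ?thesis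
    using deg finite_subset[OF sub poly_roots_finite[OF nz]] by simp
qed

lemma card_level_slopes:
  fixes a b c d M :: real
  assumes p: "p \<ge> 2" and nid: "\<not> norm_ratio_const p M a b c d"
  shows "finite (level_slopes p M a b c d) \<and> card (level_slopes p M a b c d) \<le> 4 * p"
proof (cases "M > 0")
  case False
  then have "M \<le> 0" by simp
  from card_level_slopes_nonpos[OF p this nid] p show ?thesis by linarith
next
  case True
  let ?B = "{- a / b, - c / d, 0}"
  have B: "finite ?B" "card ?B \<le> 3" by (simp_all add: card_insert_if)
  have mem: "- a / b \<in> ?B" "- c / d \<in> ?B" "0 \<in> ?B" by blast+
  note piece = card_level_slopes_piece[OF p True nid B(1) mem]
  note pieces = card_le_sum_pieces[OF B(1), of "level_slopes p M a b c d" p]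
  have "card (level_slopes p M a b c d) \<le> (card ?B + 1) * p"
    by (rule pieces(2)) (use piece in blast)+
  also have "\<dots> \<le> 4 * p" using B(2) by (intro mult_right_mono) auto
  finally have "card (level_slopes p M a b c d) \<le> 4 * p" .
  moreover have "finite (level_slopes p M a b c d)"
    by (rule pieces(1)) (use piece in blast)+
  ultimately show ?thesis by simp
qed

section \<open>Norm attainment\<close>

lemma lp_norm_power:
  assumes "p \<ge> 1"
  shows "lp_norm p v ^ p = \<bar>v $ 1\<bar> ^ p + \<bar>v $ 2\<bar> ^ p"
proof -
  have "lp_norm p v ^ p = lp_norm p v powr real p"
    using assms by (intro powr_realpow'[symmetric]) (simp_all add: lp_norm_def)
  also have "\<dots> = \<bar>v $ 1\<bar> ^ p + \<bar>v $ 2\<bar> ^ p"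
    using assms by (simp add: lp_norm_def powr_powr)
  finally show ?thesis .
qed

lemma lp_norm_eqI:
  assumes "p \<ge> 1" "r \<ge> 0" "\<bar>v $ 1\<bar> ^ p + \<bar>v $ 2\<bar> ^ p = r ^ p"
  shows "lp_norm p v = r"
proof (rule power_eq_imp_eq_base[of _ p])
  show "lp_norm p v ^ p = r ^ p" using lp_norm_power[OF assms(1)] assms(3) by simp
qed (use assms in \<open>simp_all add: lp_norm_def\<close>)

lemma linear_real2_components:
  fixes T :: "real ^ 2 \<Rightarrow> real ^ 2"
  assumes "linear T"
  shows "T v $ i = T (axis 1 1) $ i * v $ 1 + T (axis 2 1) $ i * v $ 2"
proof -
  have "v = v $ 1 *\<^sub>R axis 1 1 + v $ 2 *\<^sub>R axis 2 1"
    by (simp add: vec_eq_iff forall_2 axis_def)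
  then have "T v = T (v $ 1 *\<^sub>R axis 1 1 + v $ 2 *\<^sub>R axis 2 1)" by simp
  also have "\<dots> = v $ 1 *\<^sub>R T (axis 1 1) + v $ 2 *\<^sub>R T (axis 2 1)"
    using assms by (simp add: linear_add linear_scale)
  finally show ?thesis by simp
qed

text \<open>
  The scalar is the \<open>p\<close>-th root of \<open>M\<close>. If it is \<open>0\<close>, the operator vanishes and any isometry
  serves as the other factor.
\<close>

lemma norm_ratio_const_imp_scalar_multiple_of_isometry:
  fixes T :: "real ^ 2 \<Rightarrow> real ^ 2"
  assumes p: "p \<ge> 1" and T: "linear T"
    and ratio: "norm_ratio_const p M (T (axis 1 1) $ 1) (T (axis 2 1) $ 1)
                                     (T (axis 1 1) $ 2) (T (axis 2 1) $ 2)"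
  shows "scalar_multiple_of_lp_isometry p T"
proof -
  have eq: "\<bar>T v $ 1\<bar> ^ p + \<bar>T v $ 2\<bar> ^ p = M * (\<bar>v $ 1\<bar> ^ p + \<bar>v $ 2\<bar> ^ p)" for v
    using ratio unfolding norm_ratio_const_def linear_real2_components[OF T, of v] by blast
  have "M = \<bar>T (axis 1 1) $ 1\<bar> ^ p + \<bar>T (axis 1 1) $ 2\<bar> ^ p"
    using eq[of "axis 1 1"] p by (simp add: axis_def zero_power)
  then have "M \<ge> 0" by simp
  define m where "m = root p M"
  have m: "m \<ge> 0" "m ^ p = M"
    using \<open>M \<ge> 0\<close> p by (simp_all add: m_def)
  have norm: "lp_norm p (T v) = m * lp_norm p v" for v
    using m eq[of v] lp_norm_power[OF p, of v]
    by (intro lp_norm_eqI[OF p]) (auto simp: power_mult_distrib lp_norm_def)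
  show ?thesis
  proof (cases "m = 0")
    case True
    have "T v = 0" for v
    proof -
      have "\<bar>T v $ 1\<bar> ^ p + \<bar>T v $ 2\<bar> ^ p = 0"
        using eq[of v] m True p by (simp add: zero_power)
      then show ?thesis
        by (subst (asm) add_nonneg_eq_0_iff) (auto simp: vec_eq_iff forall_2)
    qed
    then have "T = (\<lambda>v. 0 *\<^sub>R v)" by auto
    moreover have "lp_isometry p (\<lambda>v. v)" by (simp add: lp_isometry_def linear_id[unfolded id_def])
    ultimately show ?thesis unfolding scalar_multiple_of_lp_isometry_def by blast
  next
    case False
    define U where "U = (\<lambda>v. (1 / m) *\<^sub>R T v)"
    have "\<bar>U v $ 1\<bar> ^ p + \<bar>U v $ 2\<bar> ^ p = lp_norm p v ^ p" for v
    proof -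
      have "\<bar>U v $ 1\<bar> ^ p + \<bar>U v $ 2\<bar> ^ p = (\<bar>T v $ 1\<bar> ^ p + \<bar>T v $ 2\<bar> ^ p) / m ^ p"
        using m(1) by (simp add: U_def abs_mult power_divide add_divide_distrib)
      moreover have "M \<noteq> 0" using m(2) False by auto
      ultimately show ?thesis
        using eq[of v] m(2) lp_norm_power[OF p, of v] by simp
    qed
    then have "lp_norm p (U v) = lp_norm p v" for v
      by (intro lp_norm_eqI[OF p]) (auto simp: lp_norm_def)
    moreover have "linear U" unfolding U_def using T by (rule linear_compose_scale_right)
    moreover have "T = (\<lambda>v. m *\<^sub>R U v)" using False by (simp add: U_def)
    ultimately show ?thesis
      unfolding scalar_multiple_of_lp_isometry_def lp_isometry_def by blast
  qed
qed

text \<open>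
  A point of the sphere off the second axis is determined by its slope and by the sign of its first
  coordinate; the axis itself meets the sphere in two points.
\<close>

lemma card_sphere_over_slopes:
  fixes A :: "(real ^ 2) set"
  assumes p: "p \<ge> 1" and A: "A \<subseteq> lp_sphere p"
    and slope: "\<And>v. v \<in> A \<Longrightarrow> v $ 1 \<noteq> 0 \<Longrightarrow> v $ 2 / v $ 1 \<in> Z" and "finite Z"
  shows "finite A \<and> card A \<le> 2 * card Z + 2"
proof -
  have sph: "\<bar>v $ 1\<bar> ^ p + \<bar>v $ 2\<bar> ^ p = 1" if "v \<in> A" for v
    using that A lp_norm_power[OF p, of v] by (auto simp: lp_sphere_def)
  let ?A1 = "{v \<in> A. v $ 1 \<noteq> 0}" and ?A0 = "{v \<in> A. v $ 1 = 0}"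
  let ?f = "\<lambda>v :: real ^ 2. (v $ 2 / v $ 1, sgn (v $ 1))"
  have "inj_on ?f ?A1"
  proof (rule inj_onI)
    fix v w assume v: "v \<in> ?A1" and w: "w \<in> ?A1" and "?f v = ?f w"
    then have sl: "v $ 2 / v $ 1 = w $ 2 / w $ 1" and sg: "sgn (v $ 1) = sgn (w $ 1)" by auto
    have "\<bar>u $ 1\<bar> ^ p * (1 + \<bar>u $ 2 / u $ 1\<bar> ^ p) = 1" if "u \<in> ?A1" for u
      using sph[of u] that by (simp add: abs_divide power_divide field_simps)
    from this[OF v] this[OF w]
    have "\<bar>v $ 1\<bar> ^ p * (1 + \<bar>w $ 2 / w $ 1\<bar> ^ p) = \<bar>w $ 1\<bar> ^ p * (1 + \<bar>w $ 2 / w $ 1\<bar> ^ p)"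
      unfolding sl by simp
    moreover have "1 + \<bar>w $ 2 / w $ 1\<bar> ^ p > 0" by (simp add: add_pos_nonneg)
    ultimately have "\<bar>v $ 1\<bar> ^ p = \<bar>w $ 1\<bar> ^ p" by simp
    then have "\<bar>v $ 1\<bar> = \<bar>w $ 1\<bar>" using p by (auto intro: power_eq_imp_eq_base)
    then have "v $ 1 = w $ 1" using sg by (metis mult_sgn_abs)
    with sl w have "v $ 2 = w $ 2" by simp
    with \<open>v $ 1 = w $ 1\<close> show "v = w" by (simp add: vec_eq_iff forall_2)
  qed
  moreover have sub: "?f ` ?A1 \<subseteq> Z \<times> {1, - 1}"
    using slope by (auto simp: sgn_real_def)
  ultimately have A1: "finite ?A1" "card ?A1 \<le> card (Z \<times> {1, - 1 :: real})"
    using \<open>finite Z\<close>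
    by (simp_all only: inj_on_finite[of ?f] card_inj_on_le[of ?f] finite_SigmaI finite.intros)
  have A0: "?A0 \<subseteq> {axis 2 1, axis 2 (- 1)}"
  proof
    fix v assume v: "v \<in> ?A0"
    then have "\<bar>v $ 2\<bar> ^ p = 1 ^ p" using sph[of v] p by (simp add: zero_power)
    then have "\<bar>v $ 2\<bar> = 1" by (rule power_eq_imp_eq_base) (use p in simp_all)
    with v show "v \<in> {axis 2 1, axis 2 (- 1)}"
      by (auto simp: vec_eq_iff forall_2 axis_def)
  qed
  have "card ?A0 \<le> card {axis 2 1, axis 2 (- 1) :: real ^ 2}" by (rule card_mono[OF _ A0]) simp
  also have "\<dots> \<le> 2" by (simp add: card_insert_if)
  finally have "card ?A0 \<le> 2" .
  have "finite ?A0" by (rule finite_subset[OF A0]) simp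
  have split: "A = ?A1 \<union> ?A0" by blast
  have "finite (?A1 \<union> ?A0)" using A1(1) \<open>finite ?A0\<close> by (rule finite_UnI)
  moreover have "card (?A1 \<union> ?A0) \<le> 2 * card Z + 2"
    using card_Un_le[of ?A1 ?A0] A1(2) \<open>card ?A0 \<le> 2\<close> by (simp add: card_cartesian_product)
  ultimately show ?thesis unfolding split[symmetric] ..
qed

theorem theorem2p7:
  fixes p :: nat and T :: "real ^ 2 \<Rightarrow> real ^ 2"
  assumes "p \<ge> 2"
    and "linear T"
    and "\<not> scalar_multiple_of_lp_isometry p T"
  shows "finite (norm_attainment_set p T) \<and> card (norm_attainment_set p T) \<le> 2 * (8 * p - 5)"
proof -
  define M where "M = lp_onorm p T ^ p"
  define Z where "Z = level_slopes p M (T (axis 1 1) $ 1) (T (axis 2 1) $ 1)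
    (T (axis 1 1) $ 2) (T (axis 2 1) $ 2)"
  have p: "p \<ge> 1" using assms(1) by simp
  have Z: "finite Z \<and> card Z \<le> 4 * p"
    unfolding Z_def using norm_ratio_const_imp_scalar_multiple_of_isometry[OF p assms(2)] assms(3)
    by (intro card_level_slopes[OF assms(1)]) blast
  have "v $ 2 / v $ 1 \<in> Z" if v: "v \<in> norm_attainment_set p T" "v $ 1 \<noteq> 0" for v
  proof -
    define t where "t = v $ 2 / v $ 1"
    have vt: "v $ 2 = v $ 1 * t" using v(2) by (simp add: t_def)
    have sph: "\<bar>v $ 1\<bar> ^ p + \<bar>v $ 2\<bar> ^ p = 1" and "\<bar>T v $ 1\<bar> ^ p + \<bar>T v $ 2\<bar> ^ p = M"
      using v(1) lp_norm_power[OF p, of v] lp_norm_power[OF p, of "T v"]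
      by (auto simp: norm_attainment_set_def lp_sphere_def M_def)
    then have eq: "\<bar>T v $ 1\<bar> ^ p + \<bar>T v $ 2\<bar> ^ p = M * (\<bar>v $ 1\<bar> ^ p + \<bar>v $ 2\<bar> ^ p)" by simp
    have comp: "T v $ i = v $ 1 * (T (axis 1 1) $ i + T (axis 2 1) $ i * t)" for i
      unfolding linear_real2_components[OF assms(2), of v] vt by (simp add: algebra_simps)
    have "\<bar>v $ 1\<bar> ^ p * (\<bar>T (axis 1 1) $ 1 + T (axis 2 1) $ 1 * t\<bar> ^ p
         + \<bar>T (axis 1 1) $ 2 + T (axis 2 1) $ 2 * t\<bar> ^ p) = \<bar>v $ 1\<bar> ^ p * (M * (1 + \<bar>t\<bar> ^ p))"
      using eq unfolding comp vt abs_mult power_mult_distrib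
      by (simp only: distrib_left mult_1_right ac_simps)
    with v(2) have "t \<in> Z" by (simp add: Z_def level_slopes_def)
    then show ?thesis by (simp add: t_def)
  qed
  then have "finite (norm_attainment_set p T)
      \<and> card (norm_attainment_set p T) \<le> 2 * card Z + 2"
    using Z by (intro card_sphere_over_slopes[OF p]) (auto simp: norm_attainment_set_def)
  then show ?thesis using Z assms(1) by auto
qed

end
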